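(* Let $f:\mathcal{B}_n\to\mathbb{R}$ with $\mathcal{B}_n=\{-1,1\}^n$, let $\lambda>0$, and let $p_\theta$ be a parameterized family of probability distributions on $\mathcal{B}_n$ with $p_\theta(x)>0$ for all $x$. Suppose that for any $x\in\mathcal{B}_n$, $p_\theta(x)$ is differentiable with respect to $\theta$. Let $$L_\lambda(\theta)=\mathbb{E}_{x\sim p_\theta}[f(x)]+\lambda\,\mathbb{E}_{x\sim p_\theta}[\log p_\theta(x)].$$ Then for any constant $c\in\mathbb{R}$, the gradient of $L_\lambda$ is given by $$\nabla_\theta L_\lambda(\theta)=\mathbb{E}_{x\sim p_\theta}\big[(f(x)+\lambda\log p_\theta(x)-c)\,\nabla_\theta\log p_\theta(x)\big].$$
   Context: The parameter $\theta$ ranges over a Euclidean space. *)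

theory Defs
  imports "HOL-Analysis.Analysis" "HOL-Probability.Probability"
begin

definition binary_cube :: "(real ^ 'n) set" where
  "binary_cube = {x. \<forall>i. x $ i = -1 \<or> x $ i = 1}"

text \<open>Meaningful only where \<open>g\<close> is differentiable, as with \<^const>\<open>deriv\<close>.\<close>

definition gradient :: "('a::real_inner \<Rightarrow> real) \<Rightarrow> 'a \<Rightarrow> 'a" where
  "gradient g t = (THE D. GDERIV g t :> D)"

lemma gradient_eqI:
  assumes "GDERIV g t :> D"
  shows "gradient g t = D"
  unfolding gradient_def
proof (rule the_equality)
  fix D' assume "GDERIV g t :> D'"
  then have "(\<lambda>h. h \<bullet> D') = (\<lambda>h. h \<bullet> D)"
    using assms unfolding gderiv_def by (rule has_derivative_unique)
  then have "\<forall>h. h \<bullet> D' = h \<bullet> D" by meson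
  then show "D' = D" by (simp add: vector_eq_ldot)
qed (fact assms)

definition regularized_objective ::
  "('b \<Rightarrow> real) \<Rightarrow> real \<Rightarrow> ('a \<Rightarrow> 'b pmf) \<Rightarrow> 'a \<Rightarrow> real" where
  "regularized_objective f lam p t =
     measure_pmf.expectation (p t) f
     + lam * measure_pmf.expectation (p t) (\<lambda>x. ln (pmf (p t) x))"

end

theory Submission
  imports Defs
begin

text \<open>
  On the finite cube, expectations are finite sums, so the objective is a sum of terms
  \<open>q * (f + lam * ln q)\<close> with gradient \<open>(f + lam * ln q + lam) \<nabla>q\<close>. Differentiating the
  normalisation \<open>\<Sum>q = 1\<close> gives \<open>\<Sum>\<nabla>q = 0\<close>, hence the constant \<open>lam\<close> may be replaced by \<open>- c\<close>.
  The claim follows with \<open>\<nabla>q = q \<nabla>(ln q)\<close>.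
\<close>

lemma finite_binary_cube: "finite (binary_cube :: (real ^ 'n) set)"
proof (rule finite_subset)
  show "binary_cube \<subseteq> vec_lambda ` (PiE (UNIV :: 'n set) (\<lambda>_. {-1, 1 :: real}))"
  proof
    fix x :: "real ^ 'n" assume "x \<in> binary_cube"
    then have "vec_nth x \<in> PiE UNIV (\<lambda>_. {-1, 1})"
      by (auto simp: binary_cube_def PiE_def)
    then show "x \<in> vec_lambda ` (PiE (UNIV :: 'n set) (\<lambda>_. {-1, 1 :: real}))"
      by (metis image_eqI vec_nth_inverse)
  qed
qed (intro finite_imageI finite_PiE; simp)

text \<open>The derivative is a linear functional on a Euclidean space, hence the inner product with
  a fixed vector, its adjoint applied to \<open>1\<close>. Uniqueness of gradients identifies that
  vector with \<open>gradient g t\<close>.\<close>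

lemma differentiable_GDERIV_gradient:
  fixes g :: "'a::euclidean_space \<Rightarrow> real"
  assumes "g differentiable (at t)"
  shows "GDERIV g t :> gradient g t"
proof -
  obtain g' where g': "(g has_derivative g') (at t)"
    using assms by (auto simp: differentiable_def)
  then have "linear g'"
    by (simp add: has_derivative_linear)
  then have "g' h = h \<bullet> adjoint g' 1" for h
    using adjoint_works[of g' h 1] by simp
  then have "GDERIV g t :> adjoint g' 1"
    unfolding gderiv_def by (intro has_derivative_eq_rhs[OF g'] ext)
  then show ?thesis
    by (simp add: gradient_eqI)
qed

lemma GDERIV_sum:
  assumes "\<And>x. x \<in> S \<Longrightarrow> GDERIV (g x) t :> D x"
  shows "GDERIV (\<lambda>s. \<Sum>x\<in>S. g x s) t :> (\<Sum>x\<in>S. D x)"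
  using assms unfolding gderiv_def inner_sum_right by (intro has_derivative_sum)

lemma GDERIV_ln:
  assumes "GDERIV g t :> D" and "g t > 0"
  shows "GDERIV (\<lambda>s. ln (g s)) t :> inverse (g t) *\<^sub>R D"
  using assms(1) DERIV_ln[OF assms(2)] by (rule GDERIV_DERIV_compose)

text \<open>The extra \<open>b\<close> is \<open>g t * (b / g t)\<close>, the contribution of
  differentiating the logarithm. It is applied with \<open>a = f x\<close> and
  \<open>b = lam\<close>.\<close>

lemma GDERIV_mult_affine_ln:
  assumes "GDERIV g t :> D" and "g t > 0"
  shows "GDERIV (\<lambda>s. g s * (a + b * ln (g s))) t :> (a + b * ln (g t) + b) *\<^sub>R D"
proof -
  have "((\<lambda>y. y * (a + b * ln y)) has_real_derivative (a + b * ln (g t) + b)) (at (g t))"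
    using assms(2) by (auto intro!: derivative_eq_intros)
  with assms(1) show ?thesis
    by (rule GDERIV_DERIV_compose)
qed

theorem lemma1:
  fixes f :: "real ^ 'n \<Rightarrow> real"
    and lam c :: real
    and p :: "'a::euclidean_space \<Rightarrow> (real ^ 'n) pmf"
    and \<theta> :: 'a
  assumes "lam > 0"
    and "\<And>t. set_pmf (p t) \<subseteq> binary_cube"
    and "\<And>t x. x \<in> binary_cube \<Longrightarrow> pmf (p t) x > 0"
    and "\<And>t x. x \<in> binary_cube \<Longrightarrow> (\<lambda>s. pmf (p s) x) differentiable (at t)"
  shows "GDERIV (regularized_objective f lam p) \<theta> :>
           measure_pmf.expectation (p \<theta>)
             (\<lambda>x. (f x + lam * ln (pmf (p \<theta>) x) - c) *\<^sub>R gradient (\<lambda>t. ln (pmf (p t) x)) \<theta>)"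
proof -
  let ?B = "binary_cube :: (real ^ 'n) set"
  define G where "G x = gradient (\<lambda>s. pmf (p s) x) \<theta>" for x
  define w where "w x = f x + lam * ln (pmf (p \<theta>) x)" for x
  have G: "GDERIV (\<lambda>s. pmf (p s) x) \<theta> :> G x" if "x \<in> ?B" for x
    unfolding G_def using assms(4)[OF that] by (rule differentiable_GDERIV_gradient)
  \<comment> \<open>Summing over the whole cube makes the index set independent of \<open>t\<close>,
    so that sums can be differentiated termwise.\<close>
  have real_expectation: "measure_pmf.expectation (p t) h = (\<Sum>x\<in>?B. pmf (p t) x * h x)"
    for t and h :: "real ^ 'n \<Rightarrow> real"
    using integral_measure_pmf[OF finite_binary_cube, of "p t" h] assms(2) by auto
  have "GDERIV (\<lambda>s. \<Sum>x\<in>?B. pmf (p s) x) \<theta> :> (\<Sum>x\<in>?B. G x)"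
    by (intro GDERIV_sum G)
  \<comment> \<open>The support lies in the cube, so the total mass is 1 at every
    \<open>s\<close>.\<close>
  moreover have "(\<lambda>s. \<Sum>x\<in>?B. pmf (p s) x) = (\<lambda>s. 1)"
    using assms(2) by (simp add: sum_pmf_eq_1 finite_binary_cube)
  ultimately have "GDERIV (\<lambda>s. 1) \<theta> :> (\<Sum>x\<in>?B. G x)"
    by simp
  from gradient_eqI[OF this] have sum_G: "(\<Sum>x\<in>?B. G x) = 0"
    by (simp add: gradient_eqI[OF GDERIV_const])
  have "regularized_objective f lam p =
      (\<lambda>s. \<Sum>x\<in>?B. pmf (p s) x * (f x + lam * ln (pmf (p s) x)))"
    by (rule ext) (simp add: regularized_objective_def real_expectation
        sum.distrib sum_distrib_left algebra_simps)
  then have "GDERIV (regularized_objective f lam p) \<theta> :> (\<Sum>x\<in>?B. (w x + lam) *\<^sub>R G x)"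
    unfolding w_def by (simp only:) (intro GDERIV_sum GDERIV_mult_affine_ln G assms(3))
  moreover have "(\<Sum>x\<in>?B. (w x + lam) *\<^sub>R G x) = (\<Sum>x\<in>?B. (w x - c) *\<^sub>R G x)"
  proof -
    \<comment> \<open>A constant \<open>d\<close> contributes only \<open>d\<close> times the
      vanishing sum of the \<open>G x\<close>; the cases \<open>lam\<close> and \<open>- c\<close>
      then link the two sides.\<close>
    have "(\<Sum>x\<in>?B. (w x + d) *\<^sub>R G x) = (\<Sum>x\<in>?B. w x *\<^sub>R G x)" for d
      by (simp only: scaleR_add_left sum.distrib scaleR_sum_right[symmetric] sum_G
          scaleR_zero_right add_0_right)
    from this[of lam] this[of "- c"] show ?thesis
      by simp
  qed
  moreover have "measure_pmf.expectation (p \<theta>)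
      (\<lambda>x. (w x - c) *\<^sub>R gradient (\<lambda>t. ln (pmf (p t) x)) \<theta>) = (\<Sum>x\<in>?B. (w x - c) *\<^sub>R G x)"
  proof -
    \<comment> \<open>The inverse factor cancels against the weight
      \<open>pmf (p \<theta>) x\<close> of the expectation, which is positive on the cube.\<close>
    have "gradient (\<lambda>t. ln (pmf (p t) x)) \<theta> = inverse (pmf (p \<theta>) x) *\<^sub>R G x" if "x \<in> ?B" for x
      using that by (intro gradient_eqI GDERIV_ln G assms(3))
    then have "(\<Sum>x\<in>?B. pmf (p \<theta>) x *\<^sub>R (w x - c) *\<^sub>R gradient (\<lambda>t. ln (pmf (p t) x)) \<theta>)
        = (\<Sum>x\<in>?B. (w x - c) *\<^sub>R G x)"
      using assms(3)[of _ \<theta>] by (intro sum.cong) (auto simp: less_imp_neq[symmetric])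
    \<comment> \<open>The integrand is vector-valued here, whereas \<open>real_expectation\<close>
      covers real ones, so the integral is expanded afresh.\<close>
    then show ?thesis
      by (subst integral_measure_pmf[OF finite_binary_cube]) (use assms(2) in auto)
  qed
  ultimately show ?thesis
    by (simp add: w_def)
qed

end
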